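(* Let $\mathbf n=(n_0,n_1,\ldots)$ be a sequence of (positive) natural numbers, and assume $q:=\liminf_{k\to\infty} (n_{k+1}/n_k) > 1$. Then the set $$\mathscr U:=\{\alpha\in\mathbb R/\mathbb Z:\ \mathbf n\alpha \text{ is uniformly distributed with respect to }\lambda\}$$ is meager in $\mathbb R/\mathbb Z$. Moreover, there is a number $Q>0$ such that for all intervals $I\subseteq\mathbb R/\mathbb Z$ of (positive) length less than $\frac1q$ the set $$\Bigl\{\alpha\in\mathbb R/\mathbb Z:\ \bar\mu_{\mathbf n\alpha}(I)>\frac{Q}{-\log\lambda(I)}\Bigr\}$$ is residual in $\mathbb R/\mathbb Z$. Equivalently, the set $$\Bigl\{\alpha\in\mathbb R/\mathbb Z:\ \text{for all intervals } I \text{ of (positive) length}<\tfrac1q,\ \bar\mu_{\mathbf n\alpha}(I)>\frac{Q}{-\log\lambda(I)}\Bigr\}$$ is residual in $\mathbb R/\mathbb Z$.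
   Context: $\lambda$ is Lebesgue (Haar) probability measure on $\mathbb R/\mathbb Z$; an interval in $\mathbb R/\mathbb Z$ is an arc. For $\mathbf n=(n_k)$ and $\alpha\in\mathbb R/\mathbb Z$, $\mathbf n\alpha$ denotes the sequence $(n_k\alpha)_k$ in $\mathbb R/\mathbb Z$. Let $X$ be a compact metric space and $\mathcal M(X)$ the set of Borel probability measures on $X$ with the (compact metrizable) topology of weak convergence. For a sequence $\mathbf x=(x_n)$ in $X$ let $\mu_{\mathbf x,N}=\frac1N\sum_{n}\delta_{x_n}$, the sum being over the first $N$ terms of the sequence, and let $M(\mathbf x)\subseteq\mathcal M(X)$ be the set of limit measures of $\mathbf x$, i.e. the set of accumulation points $\bigcap_{N_0\ge1}\overline{\{\mu_{\mathbf x,N}: N\ge N_0\}}$ of the sequence $(\mu_{\mathbf x,N})_N$. $\mathbf x$ is uniformly distributed with respect to $\lambda$ if $M(\mathbf x)=\{\lambda\}$. For an interval $I$, $\bar\mu_{\mathbf x}(I):=\sup\{\mu(I):\mu\in M(\mathbf x)\}$. A set is meager if it is of first Baire category, and residual if its complement is meager. If $q=\infty$, $1/q$ is read as $0$. *)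

theory Defs
  imports "HOL-Probability.Probability"
begin

section \<open>The circle group as a compact metric space\<close>

quotient_type circle = real / "\<lambda>x y. x - y \<in> \<int>"
  morphisms rep_circle proj
proof (rule equivpI)
  show "reflp (\<lambda>x y :: real. x - y \<in> \<int>)" by (rule reflpI) simp
  show "symp (\<lambda>x y :: real. x - y \<in> \<int>)" by (rule sympI) (metis Ints_minus minus_diff_eq)
  show "transp (\<lambda>x y :: real. x - y \<in> \<int>)"
  proof (rule transpI)
    fix x y z :: real assume "x - y \<in> \<int>" "y - z \<in> \<int>"
    then have "(x - y) + (y - z) \<in> \<int>" by (rule Ints_add)
    then show "x - z \<in> \<int>" by simp
  qed
qed

lemma proj_eq_iff: "proj x = proj y \<longleftrightarrow> x - y \<in> \<int>"
  by (rule circle.abs_eq_iff)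

lemma proj_surj: "\<exists>x. a = proj x"
  by (metis Quotient_circle Quotient_abs_rep)

text \<open>The multiple \<open>m \<alpha>\<close> of a point of the circle by a natural number.\<close>

lift_definition circle_mult :: "nat \<Rightarrow> circle \<Rightarrow> circle" is "\<lambda>m x. of_nat m * x"
  by (metis Ints_mult Ints_of_nat right_diff_distrib)

lemma infdist_Ints_eq: "infdist x \<int> = \<bar>x - of_int (round x)\<bar>" for x :: real
proof (rule antisym)
  show "infdist x \<int> \<le> \<bar>x - of_int (round x)\<bar>"
    by (rule order_trans[OF infdist_le[of "of_int (round x)"]]) (auto simp: dist_real_def)
  have "(INF a\<in>\<int>. dist x a) \<ge> \<bar>x - of_int (round x)\<bar>"
    by (rule cINF_greatest) (auto simp: dist_real_def elim!: Ints_cases intro: round_diff_minimal)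
  then show "\<bar>x - of_int (round x)\<bar> \<le> infdist x \<int>"
    by (subst infdist_notempty) auto
qed

lemma infdist_Ints_le: "infdist x \<int> \<le> \<bar>x - of_int m\<bar>" for x :: real
  by (simp add: infdist_Ints_eq round_diff_minimal)

lemma infdist_Ints_shift: "x - y \<in> \<int> \<Longrightarrow> infdist x \<int> = infdist y \<int>" for x y :: real
proof -
  have *: "infdist x \<int> \<le> infdist y \<int>" if xy: "x - y \<in> \<int>" for x y :: real
  proof -
    obtain m where m: "x - y = of_int m" using xy by (auto elim: Ints_cases)
    have "infdist x \<int> \<le> \<bar>x - of_int (round y + m)\<bar>" by (rule infdist_Ints_le)
    also have "\<dots> = \<bar>y - of_int (round y)\<bar>" using m by (simp add: algebra_simps)
    finally show ?thesis by (simp add: infdist_Ints_eq[of y])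
  qed
  assume "x - y \<in> \<int>"
  moreover from this have "y - x \<in> \<int>" by (metis Ints_minus minus_diff_eq)
  ultimately show ?thesis using * by (metis antisym)
qed

instantiation circle :: metric_space
begin

lift_definition dist_circle :: "circle \<Rightarrow> circle \<Rightarrow> real" is "\<lambda>x y. infdist (x - y) \<int>"
proof -
  fix x x' y y' :: real assume "x - x' \<in> \<int>" "y - y' \<in> \<int>"
  then have "(x - x') - (y - y') \<in> \<int>" by (rule Ints_diff)
  then show "infdist (x - y) \<int> = infdist (x' - y') \<int>"
    by (intro infdist_Ints_shift) (simp add: algebra_simps)
qed

definition uniformity_circle :: "(circle \<times> circle) filter" where
  "uniformity_circle = (INF e\<in>{0<..}. principal {(x, y). dist x y < e})"

definition open_circle :: "circle set \<Rightarrow> bool" where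
  "open_circle U = (\<forall>x\<in>U. eventually (\<lambda>(x', y). x' = x \<longrightarrow> y \<in> U) uniformity)"

instance
proof
  fix a b c :: circle
  show "dist a b = 0 \<longleftrightarrow> a = b"
  proof transfer
    fix x y :: real
    show "infdist (x - y) \<int> = 0 \<longleftrightarrow> x - y \<in> \<int>"
      using in_closed_iff_infdist_zero[OF closed_Ints, of "x - y"] Ints_0 by blast
  qed
  show "dist a b \<le> dist a c + dist b c"
  proof transfer
    fix x y z :: real
    have "infdist (x - y) \<int> \<le> \<bar>(x - y) - of_int (round (x - z) - round (y - z))\<bar>"
      by (rule infdist_Ints_le)
    also have "\<dots> \<le> \<bar>(x - z) - of_int (round (x - z))\<bar> + \<bar>(y - z) - of_int (round (y - z))\<bar>"
      by simp
    finally show "infdist (x - y) \<int> \<le> infdist (x - z) \<int> + infdist (y - z) \<int>"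
      by (simp add: infdist_Ints_eq)
  qed
qed (simp_all add: uniformity_circle_def open_circle_def)

end

lemma dist_proj_le: "dist (proj x) (proj y) \<le> dist x y"
  using infdist_Ints_le[of "x - y" 0] by (simp add: dist_circle.abs_eq dist_real_def)

lemma dist_proj_attained: "\<exists>x'. proj x' = proj x \<and> dist x' y = dist (proj x) (proj y)"
proof (intro exI conjI)
  let ?x' = "x - of_int (round (x - y))"
  show "proj ?x' = proj x" by (simp add: proj_eq_iff)
  show "dist ?x' y = dist (proj x) (proj y)"
    by (simp add: dist_circle.abs_eq infdist_Ints_eq dist_real_def algebra_simps)
qed

lemma continuous_on_proj: "continuous_on A proj"
  unfolding continuous_on_iff by (meson dist_proj_le order_le_less_trans)

lemma measurable_proj [measurable]: "proj \<in> borel_measurable borel"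
  by (rule borel_measurable_continuous_onI) (rule continuous_on_proj)

text \<open>The metric induces the quotient topology.\<close>

lemma open_circle_iff: "open U \<longleftrightarrow> open (proj -` U)" for U :: "circle set"
proof
  assume "open U" then show "open (proj -` U)"
    by (rule open_vimage) (rule continuous_on_proj)
next
  assume U: "open (proj -` U)"
  show "open U" unfolding open_dist
  proof
    fix a assume "a \<in> U"
    obtain x where x: "a = proj x" using proj_surj by blast
    obtain e where e: "e > 0" "\<And>y. dist y x < e \<Longrightarrow> y \<in> proj -` U"
      using U x \<open>a \<in> U\<close> unfolding open_dist by auto
    have "b \<in> U" if "dist b a < e" for b
    proof -
      obtain y where y: "b = proj y" using proj_surj by blast
      obtain y' where "proj y' = b" "dist y' x = dist b a"
        using dist_proj_attained[of y x] x y by auto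
      with e(2)[of y'] that show ?thesis by auto
    qed
    with e(1) show "\<exists>e>0. \<forall>y. dist y a < e \<longrightarrow> y \<in> U" by blast
  qed
qed

lemma compact_UNIV_circle: "compact (UNIV :: circle set)"
proof -
  have "proj x \<in> proj ` {0..1}" for x
    by (rule image_eqI[of _ _ "frac x"]) (auto simp: proj_eq_iff frac_def less_imp_le[OF frac_lt_1[unfolded frac_def]])
  then have "UNIV = proj ` {0..1}" by (metis UNIV_eq_I proj_surj)
  then show ?thesis
    by (metis compact_continuous_image continuous_on_proj compact_Icc)
qed

definition circle_lebesgue :: "circle measure" where
  "circle_lebesgue = distr (restrict_space lborel {0..<1}) borel proj"

lemma sets_circle_lebesgue [simp]: "sets circle_lebesgue = sets borel"
  by (simp add: circle_lebesgue_def)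

lemma emeasure_circle_lebesgue:
  assumes "A \<in> sets borel"
  shows "emeasure circle_lebesgue A = emeasure lborel (proj -` A \<inter> {0..<1})"
proof -
  have m: "proj \<in> measurable (restrict_space lborel {0..<1}) borel"
    by (rule measurable_restrict_space1) simp
  show ?thesis unfolding circle_lebesgue_def
    using assms by (simp add: emeasure_distr[OF m] space_restrict_space emeasure_restrict_space)
qed

lemma prob_space_circle_lebesgue: "prob_space circle_lebesgue"
  by (rule prob_spaceI)
     (simp add: emeasure_circle_lebesgue sets_eq_imp_space_eq[OF sets_circle_lebesgue])

text \<open>Arcs are the images of real intervals of any kind (open, half-open, closed).
  The length of an arc is its Lebesgue measure.\<close>

definition circle_interval :: "circle set \<Rightarrow> bool" where
  "circle_interval I \<longleftrightarrow> (\<exists>S :: real set. is_interval S \<and> I = proj ` S)"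


section \<open>Limit measures of sequences\<close>

definition prob_measures :: "'a::metric_space measure set" where
  "prob_measures = {\<mu>. prob_space \<mu> \<and> sets \<mu> = sets borel}"

text \<open>The coarsest topology making \<open>\<mu> \<mapsto> \<integral> f d\<mu>\<close> continuous for every bounded
  continuous real \<open>f\<close>; on a compact space boundedness of \<open>f\<close> is automatic.\<close>

definition weak_topology :: "'a::metric_space measure topology" where
  "weak_topology = topology_generated_by
     {{\<mu> \<in> prob_measures. integral\<^sup>L \<mu> f \<in> U} | (f :: 'a \<Rightarrow> real) U.
        continuous_on UNIV f \<and> bounded (range f) \<and> open U}"

lemma topspace_weak_topology [simp]: "topspace weak_topology = prob_measures"
proof -
  have "\<exists>(f :: 'a \<Rightarrow> real) U. prob_measures = {\<mu> \<in> prob_measures. integral\<^sup>L \<mu> f \<in> U} \<and>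
      continuous_on UNIV f \<and> bounded (range f) \<and> open U"
    by (rule exI[of _ "\<lambda>_. 0"], rule exI[of _ UNIV]) auto
  then show ?thesis unfolding weak_topology_def topology_generated_by_topspace by blast
qed

definition empirical_measure :: "(nat \<Rightarrow> 'a::metric_space) \<Rightarrow> nat \<Rightarrow> 'a measure" where
  "empirical_measure x N = distr (uniform_count_measure {..<N}) borel x"

lemma emeasure_empirical_measure:
  assumes "N > 0" "A \<in> sets borel"
  shows "emeasure (empirical_measure x N) A =
    ennreal (1 / real N * (\<Sum>n<N. measure (return borel (x n)) A))"
proof -
  have "emeasure (empirical_measure x N) A =
      emeasure (uniform_count_measure {..<N}) (x -` A \<inter> {..<N})"
    unfolding empirical_measure_def using assms
    by (subst emeasure_distr) (auto simp: space_uniform_count_measure sets_uniform_count_measure measurable_def)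
  also have "\<dots> = ennreal (real (card (x -` A \<inter> {..<N})) / real N)"
    by (subst emeasure_uniform_count_measure) auto
  also have "real (card (x -` A \<inter> {..<N})) = (\<Sum>n<N. measure (return borel (x n)) A)"
    using assms(2)
    by (simp add: measure_return indicator_def sum.If_cases vimage_def Int_def conj_commute)
  finally show ?thesis by simp
qed

lemma empirical_measure_in_prob_measures:
  "N > 0 \<Longrightarrow> empirical_measure x N \<in> prob_measures"
  unfolding prob_measures_def empirical_measure_def
  by (auto intro!: prob_space.prob_space_distr prob_space_uniform_count_measure simp: measurable_def
      space_uniform_count_measure sets_uniform_count_measure)

definition limit_measures :: "(nat \<Rightarrow> 'a::metric_space) \<Rightarrow> 'a measure set" where
  "limit_measures x =
     (\<Inter>N\<^sub>0\<in>{1..}. weak_topology closure_of {empirical_measure x N | N. N \<ge> N\<^sub>0})"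

definition uniformly_distributed_wrt :: "'a::metric_space measure \<Rightarrow> (nat \<Rightarrow> 'a) \<Rightarrow> bool" where
  "uniformly_distributed_wrt \<mu> x \<longleftrightarrow> limit_measures x = {\<mu>}"

definition upper_limit_measure :: "(nat \<Rightarrow> 'a::metric_space) \<Rightarrow> 'a set \<Rightarrow> real" where
  "upper_limit_measure x I = (SUP \<mu>\<in>limit_measures x. measure \<mu> I)"


section \<open>Baire category\<close>

definition nowhere_dense :: "'a::topological_space set \<Rightarrow> bool" where
  "nowhere_dense S \<longleftrightarrow> interior (closure S) = {}"

definition meager :: "'a::topological_space set \<Rightarrow> bool" where
  "meager S \<longleftrightarrow> (\<exists>\<F>. countable \<F> \<and> (\<forall>T\<in>\<F>. nowhere_dense T) \<and> S = \<Union>\<F>)"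

definition residual :: "'a::topological_space set \<Rightarrow> bool" where
  "residual S \<longleftrightarrow> meager (- S)"

end

theory Submission
  imports Defs "HOL-Real_Asymp.Real_Asymp"
begin

text \<open>
  Fix \<open>1 < r < q\<close>, so that \<open>n (Suc k) \<ge> r * n k\<close> from some index on. If an arc \<open>A\<close> of length
  \<open>h\<close> satisfies \<open>r ^ s * h \<ge> 2\<close>, then an interval which \<open>n k\<close> maps onto \<open>A\<close> contains a smaller
  one which \<open>n (k + s)\<close> maps onto \<open>A\<close>. Iterating, every interval contains an interval of points
  \<open>\<alpha>\<close> for which \<open>n k \<alpha>\<close> visits \<open>A\<close> at every \<open>s\<close>-th step for as long as we please. Hence for
  generic \<open>\<alpha>\<close> infinitely many empirical measures, and by compactness some limit measure, give \<open>A\<close>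
  mass at least \<open>1 / (2 * s)\<close>. The smallest admissible \<open>s\<close> is of order \<open>- ln h\<close>. It suffices to
  treat the countably many arcs with rational endpoints; as \<open>1 / (2 * s)\<close> exceeds \<open>h\<close> for small \<open>h\<close>,
  equidistribution fails as well.
\<close>

section \<open>Baire category\<close>

lemma nowhere_dense_subset: "nowhere_dense T \<Longrightarrow> S \<subseteq> T \<Longrightarrow> nowhere_dense S"
  unfolding nowhere_dense_def by (metis closure_mono interior_mono subset_empty)

text \<open>Since \<open>meager\<close> asks for an exact union, the nowhere dense pieces of
  \<open>T\<close> are cut down to \<open>S\<close>.\<close>

lemma meager_subset:
  assumes "meager T" "S \<subseteq> T"
  shows "meager S"
proof -
  obtain \<F> where \<F>: "countable \<F>" "\<forall>A\<in>\<F>. nowhere_dense A" "T = \<Union>\<F>"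
    using assms(1) unfolding meager_def by blast
  have "countable ((\<inter>) S ` \<F>)" using \<F>(1) by simp
  moreover have "\<forall>A\<in>(\<inter>) S ` \<F>. nowhere_dense A"
    using \<F>(2) by (auto intro: nowhere_dense_subset)
  moreover have "S = \<Union>((\<inter>) S ` \<F>)" using assms(2) \<F>(3) by auto
  ultimately show ?thesis unfolding meager_def by blast
qed

lemma meager_UN:
  assumes "countable J" "\<And>j. j \<in> J \<Longrightarrow> meager (A j)"
  shows "meager (\<Union>j\<in>J. A j)"
proof -
  have "\<forall>j\<in>J. \<exists>\<F>. countable \<F> \<and> (\<forall>T\<in>\<F>. nowhere_dense T) \<and> A j = \<Union>\<F>"
    using assms(2) unfolding meager_def by blast
  then obtain \<F> where \<F>: "\<And>j. j \<in> J \<Longrightarrow> countable (\<F> j)"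
      "\<And>j. j \<in> J \<Longrightarrow> \<forall>T\<in>\<F> j. nowhere_dense T" "\<And>j. j \<in> J \<Longrightarrow> A j = \<Union>(\<F> j)"
    by metis
  have "countable (\<Union>j\<in>J. \<F> j)" using assms(1) \<F>(1) by blast
  moreover have "\<forall>T\<in>(\<Union>j\<in>J. \<F> j). nowhere_dense T" using \<F>(2) by blast
  moreover have "(\<Union>j\<in>J. A j) = \<Union>(\<Union>j\<in>J. \<F> j)" using \<F>(3) by auto
  ultimately show ?thesis unfolding meager_def by blast
qed

lemma nowhere_dense_imp_meager: "nowhere_dense S \<Longrightarrow> meager S"
  unfolding meager_def by (rule exI[of _ "{S}"]) auto

lemma residual_mono: "residual S \<Longrightarrow> S \<subseteq> T \<Longrightarrow> residual T"
  unfolding residual_def by (erule meager_subset) auto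

lemma residual_INT:
  "countable J \<Longrightarrow> (\<And>j. j \<in> J \<Longrightarrow> residual (A j)) \<Longrightarrow> residual (\<Inter>j\<in>J. A j)"
  unfolding residual_def Compl_INT by (rule meager_UN)


section \<open>Arcs\<close>

text \<open>The full preimage of the image is the union of all integer translates of
  \<open>S\<close>, each of them open.\<close>

lemma open_image_proj:
  assumes "open S"
  shows "open (proj ` S)"
proof -
  have "proj -` (proj ` S) = (\<Union>m::int. (+) (of_int m) ` S)"
  proof (intro set_eqI iffI)
    fix x assume "x \<in> proj -` (proj ` S)"
    then obtain y where y: "y \<in> S" "x - y \<in> \<int>" by (auto simp: proj_eq_iff)
    then obtain m where "x = of_int m + y" by (metis Ints_cases diff_add_cancel)
    with y(1) show "x \<in> (\<Union>m::int. (+) (of_int m) ` S)" by auto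
  next
    fix x assume "x \<in> (\<Union>m::int. (+) (of_int m) ` S)"
    then obtain m :: int and y where "y \<in> S" "x = of_int m + y" by auto
    then have "y \<in> S" "proj x = proj y" by (auto simp: proj_eq_iff)
    then show "x \<in> proj -` (proj ` S)" by auto
  qed
  then show ?thesis
    using assms by (auto simp: open_circle_iff intro!: open_translation)
qed

lemma closed_arc: "closed (proj ` {a..b})"
  by (intro compact_imp_closed compact_continuous_image continuous_on_proj compact_Icc)

text \<open>A real interval exceeds its interior by at most two endpoints, so its image is the union
  of an open set and a finite one.\<close>

lemma circle_interval_borel:
  assumes "circle_interval I"
  shows "I \<in> sets borel"
proof -
  obtain S :: "real set" where S: "is_interval S" "I = proj ` S"
    using assms unfolding circle_interval_def by blast
  obtain a b where "S = {} \<or> S = UNIV \<or> S = {..<b} \<or> S = {..b} \<or> S = {a<..} \<or> S = {a..} \<or>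
      S = {a<..<b} \<or> S = {a<..b} \<or> S = {a..<b} \<or> S = {a..b}"
    using is_real_interval[OF S(1)] by blast
  then have "S - interior S \<subseteq> {a, b}" by (elim disjE) (auto simp: interior_open)
  then have "finite (S - interior S)" by (meson finite.emptyI finite.insertI finite_subset)
  then have "closed (proj ` (S - interior S))"
    by (intro compact_imp_closed finite_imp_compact finite_imageI)
  moreover have "I = proj ` interior S \<union> proj ` (S - interior S)"
    unfolding S(2) using interior_subset[of S] by auto
  moreover have "open (proj ` interior S)" by (simp add: open_image_proj)
  ultimately show ?thesis by (metis borel_closed borel_open sets.Un)
qed

text \<open>After an integer translation the left end lies in \<open>[0,1)\<close>. If the segment
  is shorter than 1, it ends before 2, so within \<open>[0,1)\<close> the arc is covered by a direct
  piece and a piece wrapped around 1, of total length \<open>d - c\<close>. Otherwise the bound is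
  at least the total mass 1.\<close>

lemma measure_closed_arc_le:
  assumes "c \<le> d"
  shows "measure circle_lebesgue (proj ` {c..d}) \<le> d - c"
proof -
  interpret prob_space circle_lebesgue by (rule prob_space_circle_lebesgue)
  define c' d' where "c' = frac c" and "d' = d - of_int \<lfloor>c\<rfloor>"
  have c': "0 \<le> c'" "c' < 1" by (simp_all add: c'_def frac_lt_1)
  have cd': "d' - c' = d - c" by (simp add: c'_def d'_def frac_def)
  have im: "x \<in> {c'..min d' 1} \<union> {0..d' - 1}"
    if x: "x \<in> proj -` proj ` {c..d}" "0 \<le> x" "x < 1" "d - c < 1" for x
  proof -
    obtain y where y: "c \<le> y" "y \<le> d" "x - y \<in> \<int>" using x(1) by (auto simp: proj_eq_iff)
    then obtain m where m: "x - (y - of_int \<lfloor>c\<rfloor>) = of_int m"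
      by (metis Ints_add Ints_cases Ints_of_int diff_diff_eq2 add_diff_eq diff_add_eq)
    have *: "c' \<le> y - of_int \<lfloor>c\<rfloor>" "y - of_int \<lfloor>c\<rfloor> \<le> d'"
      using y by (auto simp: c'_def d'_def frac_def)
    with m x c' cd' have "of_int m < (1::real)" "of_int m > (-2::real)" by linarith+
    then have "m = 0 \<or> m = -1" by linarith
    with m * x show ?thesis by auto
  qed
  show ?thesis
  proof (cases "d - c < 1")
    case True
    have "emeasure circle_lebesgue (proj ` {c..d}) =
        emeasure lborel (proj -` proj ` {c..d} \<inter> {0..<1})"
      by (intro emeasure_circle_lebesgue borel_closed closed_arc)
    also have "\<dots> \<le> emeasure lborel ({c'..min d' 1} \<union> {0..d' - 1})"
      by (intro emeasure_mono subsetI) (use im True in \<open>auto simp del: vimage_eq\<close>)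
    also have "\<dots> \<le> emeasure lborel {c'..min d' 1} + emeasure lborel {0..d' - 1}"
      by (intro emeasure_subadditive) auto
    also have "\<dots> = ennreal (d - c)"
    proof (cases "d' \<le> 1")
      case True
      then have "emeasure lborel {0..d' - 1} = 0" by (cases "d' = 1") auto
      with True c' cd' assms show ?thesis by simp
    next
      case False
      with c' cd' assms show ?thesis by (simp flip: ennreal_plus)
    qed
    finally show ?thesis using assms by (simp add: emeasure_eq_measure)
  next
    case False
    then show ?thesis using prob_le_1[of "proj ` {c..d}"] by linarith
  qed
qed

text \<open>Rational endpoints reduce the problem to countably many arcs, at the price of a factor 2
  in length.\<close>

lemma circle_interval_contains_rational_arc:
  assumes "circle_interval I" "0 < measure circle_lebesgue I"
  obtains a b where "a \<in> \<rat>" "b \<in> \<rat>" "a < b" "b \<le> a + 1"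
    "measure circle_lebesgue I / 2 < b - a" "proj ` {a..b} \<subseteq> I"
proof -
  interpret prob_space circle_lebesgue by (rule prob_space_circle_lebesgue)
  define l where "l = measure circle_lebesgue I"
  have l: "0 < l" "l \<le> 1" using assms(2) by (simp_all add: l_def)
  obtain S :: "real set" where S: "is_interval S" "I = proj ` S"
    using assms(1) unfolding circle_interval_def by blast
  \<comment> \<open>Any factor strictly between 1/2 and 1 would do. Being above 1/2 leaves slack for
    moving the ends to rationals; being below 1 contradicts the measure bound for a closed interval
    that would otherwise contain \<open>S\<close>.\<close>
  have "\<exists>x\<in>S. \<exists>y\<in>S. 3/4 * l < y - x"
  proof (rule ccontr)
    assume *: "\<not> ?thesis"
    have ne: "S \<noteq> {}" using assms(2) S(2) by auto
    then obtain z where z: "z \<in> S" by blast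
    have "bdd_below S" using * z by (intro bdd_belowI[of _ "z - 3/4 * l"]) force
    then have "S \<subseteq> {Inf S..Inf S + 3/4 * l}"
    proof (intro subsetI)
      fix y assume "y \<in> S"
      with * have "y - 3/4 * l \<le> Inf S" by (intro cInf_greatest ne) force
      with \<open>y \<in> S\<close> \<open>bdd_below S\<close> show "y \<in> {Inf S..Inf S + 3/4 * l}"
        by (auto intro: cInf_lower)
    qed
    then have "l \<le> measure circle_lebesgue (proj ` {Inf S..Inf S + 3/4 * l})"
      unfolding l_def S(2) using borel_closed[OF closed_arc]
      by (intro finite_measure_mono image_mono) auto
    also have "\<dots> \<le> 3/4 * l" using measure_closed_arc_le[of "Inf S" "Inf S + 3/4 * l"] l by simp
    finally show False using l by simp
  qed
  then obtain x y where xy: "x \<in> S" "y \<in> S" "3/4 * l < y - x" by blast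
  \<comment> \<open>Cutting down to one period is harmless: length 1 still exceeds
    \<open>l / 2\<close> because \<open>l \<le> 1\<close>.\<close>
  define y' where "y' = min y (x + 1)"
  have y': "y' \<le> y" "y' - x \<le> 1" "l / 2 < y' - x" using xy(3) l by (auto simp: y'_def min_def)
  \<comment> \<open>Half of the slack: moving both ends inwards by less than \<open>e\<close> keeps
    the length above \<open>l / 2\<close>.\<close>
  define e where "e = (y' - x - l / 2) / 2"
  have "0 < e" using y' by (simp add: e_def)
  obtain a where a: "a \<in> \<rat>" "x < a" "a < x + e" using Rats_dense_in_real[of x "x + e"] \<open>0 < e\<close> by auto
  obtain b where b: "b \<in> \<rat>" "y' - e < b" "b < y'" using Rats_dense_in_real[of "y' - e" y'] \<open>0 < e\<close> by auto
  have "l / 2 < b - a" using a b by (simp add: e_def field_simps)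
  moreover have "{a..b} \<subseteq> S"
  proof
    fix t assume "t \<in> {a..b}"
    then have "x \<le> t" "t \<le> y" using a b y' by auto
    with xy(1,2) S(1) show "t \<in> S" unfolding is_interval_1 by blast
  qed
  ultimately show ?thesis
    using a b y' l S(2) by (intro that[of a b]) (auto simp: l_def)
qed


section \<open>Limit measures\<close>

text \<open>Being eventually inside an open set passes to finite intersections and arbitrary unions,
  so only the generating sets need the convergence of integrals.\<close>

lemma limitin_weak_topologyI:
  assumes "\<And>i. M i \<in> prob_measures" "\<nu> \<in> prob_measures"
    and lim: "\<And>f :: 'a::metric_space \<Rightarrow> real. continuous_on UNIV f \<Longrightarrow> bounded (range f) \<Longrightarrow>
      ((\<lambda>i. integral\<^sup>L (M i) f) \<longlongrightarrow> integral\<^sup>L \<nu> f) F"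
  shows "limitin weak_topology M \<nu> F"
  unfolding limitin_def
proof (intro conjI allI impI)
  show "\<nu> \<in> topspace weak_topology" using assms(2) by simp
next
  fix U assume U: "openin weak_topology U \<and> \<nu> \<in> U"
  then have "generate_topology_on {{\<mu> \<in> prob_measures. integral\<^sup>L \<mu> f \<in> V} | (f :: 'a \<Rightarrow> real) V.
        continuous_on UNIV f \<and> bounded (range f) \<and> open V} U"
    unfolding weak_topology_def openin_topology_generated_by_iff by blast
  from this U[THEN conjunct2] show "\<forall>\<^sub>F i in F. M i \<in> U"
  proof induction
    case Empty then show ?case by simp
  next
    case (Int A B) then show ?case by (auto intro: eventually_conj)
  next
    case (UN K)
    then obtain A where "A \<in> K" "\<nu> \<in> A" by blast
    with UN.IH have "\<forall>\<^sub>F i in F. M i \<in> A" by blast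
    then show ?case by (rule eventually_mono) (use \<open>A \<in> K\<close> in blast)
  next
    case (Basis A)
    then obtain f :: "'a \<Rightarrow> real" and V where A: "A = {\<mu> \<in> prob_measures. integral\<^sup>L \<mu> f \<in> V}"
      "continuous_on UNIV f" "bounded (range f)" "open V" by blast
    then show ?case
      using topological_tendstoD[OF lim[OF A(2,3)] A(4)] Basis assms(1) by simp
  qed
qed

lemma measure_empirical_measure:
  assumes "0 < N" "A \<in> sets borel"
  shows "measure (empirical_measure x N) A = real (card {k. k < N \<and> x k \<in> A}) / real N"
proof -
  have "(\<Sum>k<N. measure (return borel (x k)) A) = (\<Sum>k<N. if x k \<in> A then 1 else 0)"
    using assms(2) by (intro sum.cong) (auto simp: measure_return)
  also have "\<dots> = real (card {k. k < N \<and> x k \<in> A})"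
    by (simp add: sum.If_cases lessThan_def Int_def)
  finally show ?thesis
    using assms by (simp add: measure_def emeasure_empirical_measure)
qed

text \<open>The sequence is lifted to \<open>[0,1)\<close>, where Helly's selection theorem applies.\<close>

lemma ex_limit_measure:
  fixes x :: "nat \<Rightarrow> circle" and \<sigma> :: "nat \<Rightarrow> nat"
  assumes "strict_mono \<sigma>"
  obtains \<nu> \<rho> where "\<nu> \<in> limit_measures x" "strict_mono \<rho>"
    "\<And>f :: circle \<Rightarrow> real. continuous_on UNIV f \<Longrightarrow> bounded (range f) \<Longrightarrow>
      (\<lambda>i. integral\<^sup>L (empirical_measure x (Suc (\<sigma> (\<rho> i)))) f) \<longlonglongrightarrow> integral\<^sup>L \<nu> f"
proof -
  have "\<exists>t. 0 \<le> t \<and> t < 1 \<and> proj t = x k" for k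
  proof -
    obtain s where "x k = proj s" using proj_surj by blast
    then show ?thesis
      by (intro exI[of _ "frac s"]) (simp add: frac_lt_1 proj_eq_iff, simp add: frac_def)
  qed
  then obtain t where t: "\<And>k. 0 \<le> t k" "\<And>k. t k < 1" "\<And>k. proj (t k) = x k" by metis
  \<comment> \<open>The shift to \<open>Suc N\<close> keeps the index set nonempty, so that every
    \<open>L N\<close> is a probability measure.\<close>
  define L where "L = (\<lambda>N. distr (uniform_count_measure {..<Suc N}) borel t)"
  have meas: "t \<in> measurable (uniform_count_measure {..<Suc N}) borel" for N
    by (auto simp: measurable_def space_uniform_count_measure sets_uniform_count_measure)
  have ps: "prob_space (uniform_count_measure {..<Suc N})" for N
    by (intro prob_space_uniform_count_measure) auto
  have rd: "real_distribution (L N)" for N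
    unfolding L_def by (rule prob_space.real_distribution_distr[OF ps meas])
  have push: "empirical_measure x (Suc N) = distr (L N) borel proj" for N
    unfolding L_def empirical_measure_def
    by (subst distr_distr[OF _ meas]) (auto simp: comp_def t)
  \<comment> \<open>One half-open interval carries all the mass of every \<open>L N\<close>, which
    is tightness in its simplest form.\<close>
  have one: "measure (L N) {-1<..1} = 1" for N
  proof -
    interpret real_distribution "L N" by (rule rd)
    have "AE y in L N. y \<in> {-1<..1}"
      unfolding L_def using t
      by (subst AE_distr_iff[OF meas]) (auto intro!: AE_I2 simp: less_imp_le intro: less_le_trans[of "-1" 0])
    then show ?thesis by (subst prob_eq_1) auto
  qed
  have "tight L" unfolding tight_def
  proof (intro conjI allI impI rd)
    fix \<epsilon> :: real assume "0 < \<epsilon>"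
    then show "\<exists>a b. a < b \<and> (\<forall>N. 1 - \<epsilon> < measure (L N) {a<..b})"
      using one by (intro exI[of _ "-1"] exI[of _ 1]) simp
  qed
  from tight_imp_convergent_subsubsequence[OF this assms] obtain \<rho> M
    where \<rho>: "strict_mono \<rho>" and M: "real_distribution M" "weak_conv_m (L \<circ> \<sigma> \<circ> \<rho>) M" by blast
  interpret M: real_distribution M by (rule M(1))
  \<comment> \<open>The limit on the line may charge the point 1, which lies outside
    \<open>[0,1)\<close>; pushing forward identifies it with 0.\<close>
  define \<nu> where "\<nu> = distr M borel proj"
  have \<nu>: "\<nu> \<in> prob_measures"
    unfolding \<nu>_def prob_measures_def by (auto intro!: M.prob_space_distr)
  have conv: "(\<lambda>i. integral\<^sup>L (empirical_measure x (Suc (\<sigma> (\<rho> i)))) f) \<longlonglongrightarrow> integral\<^sup>L \<nu> f"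
    if f: "continuous_on UNIV f" "bounded (range f)" for f :: "circle \<Rightarrow> real"
  proof -
    obtain B where B: "\<And>y. norm (f y) \<le> B" using f(2) unfolding bounded_iff by auto
    have fb: "f \<in> borel_measurable borel" using f(1) by (rule borel_measurable_continuous_onI)
    have "continuous_on UNIV (f \<circ> proj)"
      using f(1) by (intro continuous_on_compose continuous_on_proj) (rule continuous_on_subset, auto)
    then have "isCont (f \<circ> proj) y" for y
      using continuous_on_eq_continuous_at[OF open_UNIV, of "f \<circ> proj"] by blast
    then have "(\<lambda>i. integral\<^sup>L ((L \<circ> \<sigma> \<circ> \<rho>) i) (f \<circ> proj)) \<longlonglongrightarrow> integral\<^sup>L M (f \<circ> proj)"
      using B rd by (intro weak_conv_imp_integral_bdd_continuous_conv[OF _ M(1,2), where B = B]) auto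
    moreover have "integral\<^sup>L (empirical_measure x (Suc (\<sigma> (\<rho> i)))) f =
        integral\<^sup>L ((L \<circ> \<sigma> \<circ> \<rho>) i) (f \<circ> proj)" for i
      unfolding push
      by (subst integral_distr) (auto simp: fb comp_def real_distribution.events_eq_borel[OF rd] cong: measurable_cong_sets)
    moreover have "integral\<^sup>L \<nu> f = integral\<^sup>L M (f \<circ> proj)"
      unfolding \<nu>_def by (subst integral_distr) (auto simp: fb comp_def)
    ultimately show ?thesis by simp
  qed
  have lim: "limitin weak_topology (\<lambda>i. empirical_measure x (Suc (\<sigma> (\<rho> i)))) \<nu> sequentially"
    using \<nu> conv by (intro limitin_weak_topologyI empirical_measure_in_prob_measures) auto
  have "\<nu> \<in> weak_topology closure_of {empirical_measure x N | N. N \<ge> N0}" for N0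
    unfolding in_closure_of
  proof (intro conjI allI impI)
    show "\<nu> \<in> topspace weak_topology" using \<nu> by simp
    fix U assume "\<nu> \<in> U \<and> openin weak_topology U"
    with lim have "\<forall>\<^sub>F i in sequentially. empirical_measure x (Suc (\<sigma> (\<rho> i))) \<in> U"
      unfolding limitin_def by blast
    then obtain i0 where i0: "\<And>i. i \<ge> i0 \<Longrightarrow> empirical_measure x (Suc (\<sigma> (\<rho> i))) \<in> U"
      unfolding eventually_sequentially by blast
    define i where "i = max i0 N0"
    \<comment> \<open>Indices of a subsequence grow at least as fast as \<open>i\<close>, so each
      tail of the empirical measures is reached.\<close>
    have "i \<le> \<sigma> (\<rho> i)"
      using seq_suble[OF strict_mono_o[OF assms \<rho>], of i] by simp
    then have "N0 \<le> Suc (\<sigma> (\<rho> i))" by (simp add: i_def)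
    moreover have "empirical_measure x (Suc (\<sigma> (\<rho> i))) \<in> U" by (rule i0) (simp add: i_def)
    ultimately show "\<exists>y. y \<in> {empirical_measure x N | N. N \<ge> N0} \<and> y \<in> U" by blast
  qed
  then have "\<nu> \<in> limit_measures x" unfolding limit_measures_def by blast
  from that[OF this \<rho> conv] show ?thesis .
qed

text \<open>The portmanteau inequality for closed sets. The continuous functions \<open>f j\<close>
  dominate the indicator of \<open>F\<close>, so the lower bound survives the limit in
  \<open>i\<close>; then they decrease to that indicator as \<open>j\<close> grows.\<close>

lemma weak_limit_closed_ge:
  fixes F :: "'a::metric_space set"
  assumes M: "\<And>i::nat. M i \<in> prob_measures" and \<nu>: "\<nu> \<in> prob_measures"
    and lim: "\<And>f :: 'a \<Rightarrow> real. continuous_on UNIV f \<Longrightarrow> bounded (range f) \<Longrightarrow>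
      (\<lambda>i. integral\<^sup>L (M i) f) \<longlonglongrightarrow> integral\<^sup>L \<nu> f"
    and F: "closed F" "F \<noteq> {}" and c: "\<And>i. c \<le> measure (M i) F"
  shows "c \<le> measure \<nu> F"
proof -
  define f where "f = (\<lambda>j::nat. \<lambda>x. max 0 (1 - real j * infdist x F))"
  have f01: "0 \<le> f j x" "f j x \<le> 1" for j x
    by (auto simp: f_def infdist_nonneg)
  have cont: "continuous_on UNIV (f j)" for j
    unfolding f_def by (intro continuous_intros)
  have bdd: "bounded (range (f j))" for j
    unfolding bounded_iff using f01 by (intro exI[of _ 1]) auto
  have fb: "f j \<in> borel_measurable borel" for j
    using cont by (rule borel_measurable_continuous_onI)
  have Fb: "F \<in> sets borel" using F(1) by simp
  have int: "integrable \<mu> (f j)" if "\<mu> \<in> prob_measures" for \<mu> j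
  proof -
    interpret prob_space \<mu> using that by (simp add: prob_measures_def)
    have "sets \<mu> = sets borel" using that by (simp add: prob_measures_def)
    then have "f j \<in> borel_measurable \<mu>" using fb by (simp cong: measurable_cong_sets)
    then show ?thesis using f01 by (intro integrable_const_bound[of _ 1]) auto
  qed
  have ge: "c \<le> integral\<^sup>L \<nu> (f j)" for j
  proof (rule LIMSEQ_le_const[OF lim[OF cont bdd]], intro exI allI impI)
    fix i :: nat
    interpret prob_space "M i" using M by (simp add: prob_measures_def)
    have s: "F \<in> sets (M i)" using M[of i] Fb by (simp add: prob_measures_def)
    have "measure (M i) F = integral\<^sup>L (M i) (indicator F)" using s by simp
    also have "\<dots> \<le> integral\<^sup>L (M i) (f j)"
      using s f01 by (intro integral_mono int M) (auto simp: indicator_def f_def less_top[symmetric])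
    finally show "c \<le> integral\<^sup>L (M i) (f j)" using c[of i] by simp
  qed
  interpret \<nu>: prob_space \<nu> using \<nu> by (simp add: prob_measures_def)
  have sets: "sets \<nu> = sets borel" using \<nu> by (simp add: prob_measures_def)
  have "(\<lambda>j. integral\<^sup>L \<nu> (f j)) \<longlonglongrightarrow> integral\<^sup>L \<nu> (indicator F)"
  proof (rule integral_dominated_convergence[where w = "\<lambda>_. 1"])
    show "indicator F \<in> borel_measurable \<nu>" using Fb sets by simp
    show "f j \<in> borel_measurable \<nu>" for j using fb sets by (simp cong: measurable_cong_sets)
    show "integrable \<nu> (\<lambda>_. 1 :: real)" by simp
    show "AE x in \<nu>. norm (f j x) \<le> 1" for j using f01 by auto
    have "(\<lambda>j. f j x) \<longlonglongrightarrow> indicator F x" for x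
    proof (cases "x \<in> F")
      case True then show ?thesis by (simp add: f_def)
    next
      case False
      \<comment> \<open>Closedness makes the distance positive off \<open>F\<close>. For empty
        \<open>F\<close> the distance would be 0 by convention.\<close>
      then have "0 < infdist x F" using F by (metis in_closed_iff_infdist_zero infdist_nonneg less_eq_real_def)
      then obtain j0 where j0: "1 < real j0 * infdist x F" using ex_less_of_nat_mult by blast
      have "f j x = 0" if "j \<ge> j0" for j
      proof -
        have "real j0 * infdist x F \<le> real j * infdist x F"
          using that by (intro mult_right_mono) (auto simp: infdist_nonneg)
        with j0 show ?thesis by (simp add: f_def)
      qed
      then have "\<forall>\<^sub>F j in sequentially. f j x = 0" unfolding eventually_sequentially by blast
      with False show ?thesis by (simp add: tendsto_eventually)
    qed
    then show "AE x in \<nu>. (\<lambda>j. f j x) \<longlonglongrightarrow> indicator F x" by simp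
  qed
  then have "c \<le> integral\<^sup>L \<nu> (indicator F)" using ge by (intro LIMSEQ_le_const) auto
  then show ?thesis using Fb sets by simp
qed

lemma limit_measures_subset: "limit_measures x \<subseteq> prob_measures"
proof -
  have "limit_measures x \<subseteq> weak_topology closure_of {empirical_measure x N | N. N \<ge> 1}"
    unfolding limit_measures_def by (rule INT_lower) simp
  also have "\<dots> \<subseteq> topspace weak_topology" by (rule closure_of_subset_topspace)
  finally show ?thesis by simp
qed

text \<open>Compactness applied along the infinitely many good indices yields a limit measure, and
  closedness of \<open>F\<close> preserves the bound.\<close>

lemma ex_limit_measure_closed_ge:
  fixes x :: "nat \<Rightarrow> circle"
  assumes F: "closed F" "F \<noteq> {}"
    and freq: "\<And>N0. \<exists>N\<ge>N0. 0 < N \<and> c \<le> measure (empirical_measure x N) F"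
  shows "\<exists>\<nu>\<in>limit_measures x. c \<le> measure \<nu> F"
proof -
  define P where "P = {N. c \<le> measure (empirical_measure x (Suc N)) F}"
  have "\<exists>N\<in>P. N > m" for m
  proof -
    \<comment> \<open>The 2 compensates for the shift by one in \<open>P\<close>:
      \<open>N - 1\<close> must still exceed \<open>m\<close>.\<close>
    obtain N where "N \<ge> m + 2" "c \<le> measure (empirical_measure x N) F" using freq by blast
    then show ?thesis by (intro bexI[of _ "N - 1"]) (auto simp: P_def)
  qed
  then have "infinite P" by (simp add: infinite_nat_iff_unbounded) blast
  define \<sigma> where "\<sigma> = enumerate P"
  have \<sigma>: "strict_mono \<sigma>" "\<And>i. \<sigma> i \<in> P"
    unfolding \<sigma>_def using \<open>infinite P\<close> by (auto simp: strict_mono_enumerate enumerate_in_set)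
  obtain \<nu> \<rho> where \<nu>: "\<nu> \<in> limit_measures x" "strict_mono \<rho>"
    and lim: "\<And>f :: circle \<Rightarrow> real. continuous_on UNIV f \<Longrightarrow> bounded (range f) \<Longrightarrow>
      (\<lambda>i. integral\<^sup>L (empirical_measure x (Suc (\<sigma> (\<rho> i)))) f) \<longlonglongrightarrow> integral\<^sup>L \<nu> f"
    using ex_limit_measure[OF \<sigma>(1)] by blast
  have \<nu>_prob: "\<nu> \<in> prob_measures" using \<nu>(1) limit_measures_subset by blast
  have "c \<le> measure \<nu> F"
  proof (rule weak_limit_closed_ge[where M = "\<lambda>i. empirical_measure x (Suc (\<sigma> (\<rho> i)))"])
    show "empirical_measure x (Suc (\<sigma> (\<rho> i))) \<in> prob_measures" for i
      by (rule empirical_measure_in_prob_measures) simp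
    show "c \<le> measure (empirical_measure x (Suc (\<sigma> (\<rho> i)))) F" for i
      using \<sigma>(2) unfolding P_def by blast
  qed (fact \<nu>_prob lim F)+
  with \<nu>(1) show ?thesis by blast
qed

lemma upper_limit_measure_ge:
  assumes "\<mu> \<in> limit_measures x" "A \<in> sets borel" "B \<subseteq> A"
  shows "measure \<mu> B \<le> upper_limit_measure x A"
proof -
  have ps: "prob_space \<nu>" "sets \<nu> = sets borel" if "\<nu> \<in> limit_measures x" for \<nu>
    using that limit_measures_subset by (auto simp: prob_measures_def)
  interpret prob_space \<mu> by (rule ps[OF assms(1)])
  have "measure \<mu> B \<le> measure \<mu> A"
    using assms ps(2)[OF assms(1)] by (intro finite_measure_mono) auto
  also have "\<dots> \<le> upper_limit_measure x A"
    unfolding upper_limit_measure_def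
    using ps(1) by (intro cSUP_upper assms(1) bdd_aboveI2[of _ _ 1]) (auto intro: prob_space.prob_le_1)
  finally show ?thesis .
qed


section \<open>Lacunary sequences\<close>

text \<open>Multiplication by \<open>m\<close> stretches \<open>[u,v]\<close> to length at least
  \<open>1 + (b - a)\<close>, enough to contain a full integer translate of
  \<open>[a,b]\<close>.\<close>

lemma ex_shifted_Icc:
  fixes u v m a b :: real
  assumes "0 < m" "1 + (b - a) \<le> m * (v - u)"
  shows "\<exists>j::int. u \<le> (a + of_int j) / m \<and> (b + of_int j) / m \<le> v"
proof (intro exI conjI)
  define j where "j = \<lceil>m * u - a\<rceil>"
  have j: "m * u - a \<le> of_int j" "of_int j < m * u - a + 1"
    unfolding j_def by linarith+
  then show "u \<le> (a + of_int j) / m" using assms(1) by (simp add: field_simps)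
  have "m * (v - u) = m * v - m * u" by (simp add: algebra_simps)
  with j assms have "b + of_int j \<le> m * v" by linarith
  then show "(b + of_int j) / m \<le> v" using assms(1) by (simp add: field_simps)
qed

text \<open>A real \<open>r\<close> below \<open>q\<close> lets \<open>q = \<infinity>\<close> be
  treated like a finite value; the growth starts at \<open>K\<close> because a liminf controls only
  a tail.\<close>

locale lacunary =
  fixes n :: "nat \<Rightarrow> nat" and r :: real and K :: nat
  assumes r_gt_1: "1 < r" and pos: "0 < n k"
    and growth: "K \<le> k \<Longrightarrow> r * real (n k) \<le> real (n (Suc k))"
begin

lemma growth_power: "K \<le> k \<Longrightarrow> r ^ s * real (n k) \<le> real (n (k + s))"
proof (induction s)
  case (Suc s)
  have "r ^ Suc s * real (n k) = r * (r ^ s * real (n k))" by simp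
  also have "\<dots> \<le> r * real (n (k + s))" using Suc r_gt_1 by (intro mult_left_mono) auto
  also have "\<dots> \<le> real (n (k + Suc s))" using growth[of "k + s"] Suc.prems by simp
  finally show ?case .
qed simp

lemma ex_large: "\<exists>k\<ge>K. C \<le> real (n k)"
proof -
  obtain s where "C < r ^ s" using real_arch_pow[OF r_gt_1] by blast
  also have "r ^ s * 1 \<le> r ^ s * real (n K)"
    using r_gt_1 pos[of K] by (intro mult_left_mono) auto
  then have "r ^ s \<le> real (n (K + s))" using growth_power[of K s] by simp
  finally show ?thesis by (intro exI[of _ "K + s"]) auto
qed

text \<open>The threshold 2 bounds \<open>1 + (b - a)\<close>, the room needed for a full preimage
  of the arc. The exact length in the conclusion is the invariant of the induction: multiplied by
  the next term of the sequence it is at least \<open>r ^ s * (b - a)\<close>, hence again at least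
  2.\<close>

lemma nested_intervals:
  assumes k: "K \<le> k" and ab: "a < b" "b \<le> a + 1" and s: "2 \<le> r ^ s * (b - a)"
    and uv: "2 \<le> real (n k) * (v - u)"
  shows "\<exists>c d. u \<le> c \<and> c < d \<and> d \<le> v \<and> real (n (k + t * s)) * (d - c) = b - a \<and>
    (\<forall>i\<le>t. \<forall>x\<in>{c..d}. circle_mult (n (k + i * s)) (proj x) \<in> proj ` {a..b})"
proof -
  have step: "\<exists>c d. u \<le> c \<and> c < d \<and> d \<le> v \<and> real (n l) * (d - c) = b - a \<and>
      (\<forall>x\<in>{c..d}. circle_mult (n l) (proj x) \<in> proj ` {a..b})"
    if luv: "2 \<le> real (n l) * (v - u)" for l u v
  proof -
    have n: "0 < real (n l)" using pos by simp
    obtain j :: int where j: "u \<le> (a + of_int j) / real (n l)" "(b + of_int j) / real (n l) \<le> v"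
      using ex_shifted_Icc[OF n, of b a v u] luv ab by auto
    have "circle_mult (n l) (proj x) \<in> proj ` {a..b}"
      if "x \<in> {(a + of_int j) / real (n l)..(b + of_int j) / real (n l)}" for x
    proof (rule image_eqI)
      show "circle_mult (n l) (proj x) = proj (real (n l) * x - of_int j)"
        by (simp add: circle_mult.abs_eq proj_eq_iff)
      show "real (n l) * x - of_int j \<in> {a..b}" using that n by (simp add: field_simps)
    qed
    moreover have "(a + of_int j) / real (n l) < (b + of_int j) / real (n l)"
      using ab n by (intro divide_strict_right_mono) auto
    moreover have "real (n l) * ((b + of_int j) / real (n l) - (a + of_int j) / real (n l)) = b - a"
      using n by (simp flip: diff_divide_distrib)
    ultimately show ?thesis using j by blast
  qed
  show ?thesis
  proof (induction t)
    case 0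
    show ?case using step[OF uv] by simp
  next
    case (Suc t)
    then obtain c d where cd: "u \<le> c" "c < d" "d \<le> v" "real (n (k + t * s)) * (d - c) = b - a"
      "\<And>i x. i \<le> t \<Longrightarrow> x \<in> {c..d} \<Longrightarrow> circle_mult (n (k + i * s)) (proj x) \<in> proj ` {a..b}"
      by blast
    have "2 \<le> r ^ s * (b - a)" by (rule s)
    also have "\<dots> = (r ^ s * real (n (k + t * s))) * (d - c)" by (simp flip: cd(4))
    also have "\<dots> \<le> real (n (k + t * s + s)) * (d - c)"
      using growth_power[of "k + t * s" s] k cd(2) by (intro mult_right_mono) auto
    also have "k + t * s + s = k + Suc t * s" by simp
    finally obtain c' d' where cd': "c \<le> c'" "c' < d'" "d' \<le> d"
      "real (n (k + Suc t * s)) * (d' - c') = b - a"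
      "\<And>x. x \<in> {c'..d'} \<Longrightarrow> circle_mult (n (k + Suc t * s)) (proj x) \<in> proj ` {a..b}"
      using step[of "k + Suc t * s" d c] by blast
    have "circle_mult (n (k + i * s)) (proj x) \<in> proj ` {a..b}"
      if "i \<le> Suc t" "x \<in> {c'..d'}" for i x
      using that cd(5)[of i x] cd'(1,3,5) by (cases "i = Suc t") auto
    with cd cd' show ?case by (intro exI[of _ c'] exI[of _ d']) auto
  qed
qed

section \<open>Frequent visits to an arc for residually many points\<close>

lemma ex_interval_frequent:
  assumes ab: "a < b" "b \<le> a + 1" and s: "2 \<le> r ^ s * (b - a)" "0 < s" and uv: "u < v"
  shows "\<exists>c d N. u \<le> c \<and> c < d \<and> d \<le> v \<and> N0 \<le> N \<and> 0 < N \<and>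
    (\<forall>x\<in>{c..d}. 1 / (2 * real s) \<le>
      measure (empirical_measure (\<lambda>k. circle_mult (n k) (proj x)) N) (proj ` {a..b}))"
proof -
  obtain k where k: "K \<le> k" "2 / (v - u) \<le> real (n k)" using ex_large by blast
  \<comment> \<open>With \<open>k \<le> t\<close> the uncontrolled first \<open>k\<close> terms at
    most double the count: \<open>N \<le> 2 * s * (t + 1)\<close>, against \<open>t + 1\<close>
    visits. The summand \<open>N0\<close> makes \<open>N\<close> large.\<close>
  define t where "t = k + N0"
  \<comment> \<open>The final 1 includes the last visit, at index \<open>k + t * s\<close>.\<close>
  define N where "N = k + t * s + 1"
  have "2 \<le> real (n k) * (v - u)" using k(2) uv by (simp add: field_simps)
  from nested_intervals[OF k(1) ab s(1) this, of t] obtain c d where cd: "u \<le> c" "c < d" "d \<le> v"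
    "\<And>i x. i \<le> t \<Longrightarrow> x \<in> {c..d} \<Longrightarrow> circle_mult (n (k + i * s)) (proj x) \<in> proj ` {a..b}" by blast
  have "t \<le> t * s" using s(2) by simp
  then have N: "N0 \<le> N" "0 < N" "N \<le> 2 * s * (t + 1)"
    using s(2) by (auto simp: N_def t_def algebra_simps)
  have "1 / (2 * real s) \<le> measure (empirical_measure (\<lambda>k. circle_mult (n k) (proj x)) N) (proj ` {a..b})"
    if "x \<in> {c..d}" for x
  proof -
    let ?H = "{l. l < N \<and> circle_mult (n l) (proj x) \<in> proj ` {a..b}}"
    have "t + 1 = card ((\<lambda>i. k + i * s) ` {..t})"
      using s(2) by (subst card_image) (auto simp: inj_on_def)
    also have "\<dots> \<le> card ?H"
      using cd(4) that by (intro card_mono) (auto simp: N_def less_Suc_eq_le)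
    finally have "2 * s * (t + 1) \<le> 2 * s * card ?H" by (rule mult_le_mono2)
    with N(3) have "N \<le> 2 * s * card ?H" by (rule order_trans)
    then have "real N \<le> real (2 * s * card ?H)" by (rule of_nat_mono)
    then have "1 / (2 * real s) \<le> real (card ?H) / real N"
      using N(2) s(2) by (simp add: field_simps)
    then show ?thesis
      using N(2) borel_closed[OF closed_arc] by (subst measure_empirical_measure) auto
  qed
  with cd N show ?thesis by blast
qed

text \<open>Each \<open>D N0\<close> contains an open arc inside every nonempty open set, so its
  complement is nowhere dense. A point in all \<open>D N0\<close> has infinitely many good empirical
  measures, hence a good limit measure.\<close>

lemma residual_limit_measure_ge:
  assumes ab: "a < b" "b \<le> a + 1" and s: "2 \<le> r ^ s * (b - a)" "0 < s"
  shows "residual {\<alpha>. \<exists>\<nu>\<in>limit_measures (\<lambda>k. circle_mult (n k) \<alpha>).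
    1 / (2 * real s) \<le> measure \<nu> (proj ` {a..b})}"
proof -
  define D where "D = (\<lambda>N0. {\<alpha>. \<exists>N\<ge>N0. 0 < N \<and>
    1 / (2 * real s) \<le> measure (empirical_measure (\<lambda>k. circle_mult (n k) \<alpha>) N) (proj ` {a..b})})"
  have "nowhere_dense (- D N0)" for N0
    unfolding nowhere_dense_def
  proof (rule ccontr)
    define U where "U = proj -` interior (closure (- D N0))"
    assume "interior (closure (- D N0)) \<noteq> {}"
    then obtain \<alpha> where "\<alpha> \<in> interior (closure (- D N0))" by blast
    then obtain z where "z \<in> U" unfolding U_def using proj_surj[of \<alpha>] by auto
    moreover have "open U" unfolding U_def by (simp flip: open_circle_iff)
    ultimately obtain e where e: "0 < e" "cball z e \<subseteq> U" using open_contains_cball by blast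
    obtain c d N where cd: "z - e \<le> c" "c < d" "d \<le> z + e" "N0 \<le> N" "0 < N"
      "\<forall>x\<in>{c..d}. 1 / (2 * real s) \<le>
        measure (empirical_measure (\<lambda>k. circle_mult (n k) (proj x)) N) (proj ` {a..b})"
      using ex_interval_frequent[OF ab s, of "z - e" "z + e" N0] e(1) by auto
    have "{c<..<d} \<subseteq> cball z e" using cd(1,3) by (auto simp: dist_real_def)
    with e(2) have "proj ` {c<..<d} \<subseteq> interior (closure (- D N0))" unfolding U_def by blast
    with interior_subset have sub: "proj ` {c<..<d} \<subseteq> closure (- D N0)" by (rule order_trans[rotated])
    have "proj x \<in> D N0" if "x \<in> {c<..<d}" for x
    proof -
      have "x \<in> {c..d}" using that by simp
      with cd(4-6) show ?thesis unfolding D_def by blast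
    qed
    then have "proj ` {c<..<d} \<inter> - D N0 = {}" by blast
    \<comment> \<open>An open set disjoint from a set is disjoint from its closure.\<close>
    then have "proj ` {c<..<d} \<inter> closure (- D N0) = {}"
      by (simp add: open_Int_closure_eq_empty open_image_proj)
    moreover have "proj ((c + d) / 2) \<in> proj ` {c<..<d}" using cd(2) by (intro imageI) simp
    ultimately show False using sub by blast
  qed
  then have "residual (\<Inter>N0. D N0)"
    by (intro residual_INT) (auto simp: residual_def nowhere_dense_imp_meager)
  then show ?thesis
  proof (rule residual_mono)
    show "(\<Inter>N0. D N0) \<subseteq> {\<alpha>. \<exists>\<nu>\<in>limit_measures (\<lambda>k. circle_mult (n k) \<alpha>).
        1 / (2 * real s) \<le> measure \<nu> (proj ` {a..b})}"
      using ab by (auto simp: D_def intro!: ex_limit_measure_closed_ge closed_arc)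
  qed
qed

text \<open>Only rational endpoints and natural \<open>s\<close> are quantified, so this is a
  countable intersection; a single residual set then serves all intervals at once.\<close>

definition generic :: "circle set" where
  "generic = {\<alpha>. \<forall>a\<in>\<rat>. \<forall>b\<in>\<rat>. \<forall>s>0. a < b \<and> b \<le> a + 1 \<and> 2 \<le> r ^ s * (b - a) \<longrightarrow>
    (\<exists>\<nu>\<in>limit_measures (\<lambda>k. circle_mult (n k) \<alpha>). 1 / (2 * real s) \<le> measure \<nu> (proj ` {a..b}))}"

lemma residual_generic: "residual generic"
proof -
  define J where "J = {(a, b, s). a \<in> \<rat> \<and> b \<in> \<rat> \<and> 0 < s \<and> a < b \<and> b \<le> a + 1 \<and> 2 \<le> r ^ s * (b - a)}"
  have "countable J"
    by (rule countable_subset[of _ "\<rat> \<times> \<rat> \<times> UNIV"]) (auto simp: J_def countable_rat)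
  then have "residual (\<Inter>(a, b, s)\<in>J. {\<alpha>. \<exists>\<nu>\<in>limit_measures (\<lambda>k. circle_mult (n k) \<alpha>).
      1 / (2 * real s) \<le> measure \<nu> (proj ` {a..b})})"
    by (rule residual_INT) (auto simp: J_def intro: residual_limit_measure_ge)
  then show ?thesis
    by (rule residual_mono) (auto simp: J_def generic_def)
qed

text \<open>The guaranteed mass \<open>1 / (2 * s)\<close> decays more slowly in \<open>s\<close>
  than the required length \<open>2 / r ^ s\<close>, so some arc receives more limit mass than its
  length.\<close>

lemma generic_not_uniformly_distributed:
  assumes "\<alpha> \<in> generic"
  shows "\<not> uniformly_distributed_wrt circle_lebesgue (\<lambda>k. circle_mult (n k) \<alpha>)"
proof
  assume "uniformly_distributed_wrt circle_lebesgue (\<lambda>k. circle_mult (n k) \<alpha>)"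
  then have ud: "limit_measures (\<lambda>k. circle_mult (n k) \<alpha>) = {circle_lebesgue}"
    by (simp add: uniformly_distributed_wrt_def)
  have "(\<lambda>s. real s / r ^ s) \<longlonglongrightarrow> 0"
    using r_gt_1 by real_asymp
  \<comment> \<open>The bound 1/4 is exactly what makes
    \<open>2 / r ^ s < 1 / (2 * s)\<close>.\<close>
  then have "\<forall>\<^sub>F s in sequentially. real s / r ^ s < 1 / 4"
    by (rule order_tendstoD) simp
  then have "\<forall>\<^sub>F s in sequentially. real s / r ^ s < 1 / 4 \<and> 0 < s"
    by (intro eventually_conj eventually_gt_at_top)
  then obtain s where s: "real s / r ^ s < 1 / 4" "0 < s"
    using eventually_happens'[OF sequentially_bot] by blast
  have rs: "0 < r ^ s" using r_gt_1 by simp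
  have "2 / r ^ s < 1 / (2 * real s)" using s rs by (simp add: field_simps)
  then obtain h where h: "h \<in> \<rat>" "2 / r ^ s < h" "h < 1 / (2 * real s)"
    using Rats_dense_in_real by blast
  have h0: "0 < h" using h(2) rs by (meson less_trans divide_pos_pos zero_less_numeral)
  have "1 / (2 * real s) \<le> 1" using s(2) by simp
  with h(3) have "h \<le> 0 + 1" by linarith
  moreover have "2 \<le> r ^ s * (h - 0)" using h(2) rs by (simp add: field_simps)
  ultimately have "\<exists>\<nu>\<in>limit_measures (\<lambda>k. circle_mult (n k) \<alpha>).
      1 / (2 * real s) \<le> measure \<nu> (proj ` {0..h})"
    using assms h(1) s(2) Rats_0 h0 unfolding generic_def by blast
  then have "1 / (2 * real s) \<le> measure circle_lebesgue (proj ` {0..h})"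
    unfolding ud by simp
  also have "\<dots> \<le> h" using measure_closed_arc_le[of 0 h] h0 by simp
  finally show False using h(3) by simp
qed

text \<open>An arc of length \<open>l < 1 / r\<close> contains a rational arc longer than \<open>l / 2\<close>, so a
  return time \<open>s \<le> log r (4 / l) + 1 \<le> (2 + ln 4 / ln r) / ln r * - ln l\<close> suffices.\<close>

definition gap_const :: real where
  "gap_const = ln r / (4 * (2 + ln 4 / ln r))"

lemma gap_const_pos: "0 < gap_const"
  unfolding gap_const_def using r_gt_1 by (intro divide_pos_pos) (auto intro!: add_pos_nonneg)

lemma generic_upper_limit_measure:
  assumes \<alpha>: "\<alpha> \<in> generic" and I: "circle_interval I" "0 < measure circle_lebesgue I"
    "measure circle_lebesgue I < 1 / r"
  shows "gap_const / (- ln (measure circle_lebesgue I)) < upper_limit_measure (\<lambda>k. circle_mult (n k) \<alpha>) I"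
proof -
  define l where "l = measure circle_lebesgue I"
  obtain a b where ab: "a \<in> \<rat>" "b \<in> \<rat>" "a < b" "b \<le> a + 1" "l / 2 < b - a" "proj ` {a..b} \<subseteq> I"
    using circle_interval_contains_rational_arc[OF I(1,2)] unfolding l_def by blast
  have l: "0 < l" "l < 1 / r" using I by (simp_all add: l_def)
  define R where "R = ln r"
  define L where "L = - ln l"
  have R: "0 < R" using r_gt_1 by (simp add: R_def)
  have "ln l < ln (1 / r)" using l r_gt_1 by simp
  then have L: "R < L" using r_gt_1 by (simp add: L_def R_def ln_div)
  \<comment> \<open>Since \<open>b - a\<close> exceeds \<open>l / 2\<close>,
    \<open>r ^ s \<ge> 4 / l\<close> is enough for the requirement with 2.\<close>
  define s where "s = nat \<lceil>log r (4 / l)\<rceil>"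
  have logeq: "log r (4 / l) = (ln 4 + L) / R" using l by (simp add: log_def ln_div L_def R_def)
  have "0 < log r (4 / l)" unfolding logeq using R L by (intro divide_pos_pos) (auto intro: add_pos_pos)
  then have s: "0 < s" "log r (4 / l) \<le> real s" "real s \<le> log r (4 / l) + 1"
    unfolding s_def by linarith+
  have "4 / l = r powr (log r (4 / l))" using l r_gt_1 by simp
  also have "\<dots> \<le> r powr (real s)" using s(2) r_gt_1 by (intro powr_mono) auto
  also have "\<dots> = r ^ s" using r_gt_1 by (simp add: powr_realpow)
  finally have rs: "4 / l \<le> r ^ s" .
  have "2 = 4 / l * (l / 2)" using l by simp
  also have "\<dots> \<le> r ^ s * (b - a)" using rs ab l r_gt_1 by (intro mult_mono) auto
  finally obtain \<nu> where \<nu>: "\<nu> \<in> limit_measures (\<lambda>k. circle_mult (n k) \<alpha>)"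
    "1 / (2 * real s) \<le> measure \<nu> (proj ` {a..b})"
    using \<alpha> ab s(1) unfolding generic_def by blast
  have "real s \<le> (ln 4 + L) / R + 1" using s(3) logeq by simp
  \<comment> \<open>Here \<open>l < 1 / r\<close> enters: it gives \<open>L / R \<ge> 1\<close>,
    which absorbs the additive constants into a multiple of \<open>L\<close>.\<close>
  also have "\<dots> \<le> (ln 4 * (L / R) + L) / R + L / R"
  proof -
    have "1 \<le> L / R" using R L by simp
    then have "ln 4 * 1 \<le> ln 4 * (L / R)" by (intro mult_left_mono) auto
    with \<open>1 \<le> L / R\<close> R show ?thesis by (intro add_mono divide_right_mono) auto
  qed
  also have "\<dots> = L * ((2 + ln 4 / R) / R)" using R by (simp add: field_simps)
  finally have sL: "real s \<le> L * ((2 + ln 4 / R) / R)" .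
  have C: "0 < 2 + ln 4 / R" using R by (auto intro!: add_pos_nonneg)
  \<comment> \<open>The 4 in \<open>gap_const\<close>, in place of 2, yields the strict
    inequality.\<close>
  have "gap_const / L = 1 / (4 * (L * ((2 + ln 4 / R) / R)))"
    unfolding gap_const_def R_def[symmetric] using R L C by simp
  also have "\<dots> \<le> 1 / (4 * real s)" by (intro frac_le mult_left_mono sL) (use s(1) in auto)
  also have "\<dots> < 1 / (2 * real s)" using s(1) by (simp add: field_simps)
  also have "\<dots> \<le> measure \<nu> (proj ` {a..b})" by (rule \<nu>(2))
  also have "\<dots> \<le> upper_limit_measure (\<lambda>k. circle_mult (n k) \<alpha>) I"
    by (rule upper_limit_measure_ge[OF \<nu>(1) circle_interval_borel[OF I(1)] ab(6)])
  finally show ?thesis by (simp add: L_def l_def)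
qed

end

section \<open>Assembly of the theorem\<close>

theorem theorem2p4:
  fixes n :: "nat \<Rightarrow> nat" and q :: ereal
  assumes "\<And>k. 0 < n k"
    and "q = liminf (\<lambda>k. ereal (real (n (Suc k)) / real (n k)))"
    and "1 < q"
  shows "meager {\<alpha>. uniformly_distributed_wrt circle_lebesgue (\<lambda>k. circle_mult (n k) \<alpha>)} \<and>
    (\<exists>Q::real. Q > 0 \<and>
      (\<forall>I. circle_interval I \<and> 0 < measure circle_lebesgue I \<and>
            ereal (measure circle_lebesgue I) < 1 / q \<longrightarrow>
          residual {\<alpha>. upper_limit_measure (\<lambda>k. circle_mult (n k) \<alpha>) I
                        > Q / (- ln (measure circle_lebesgue I))}) \<and>
      residual {\<alpha>. \<forall>I. circle_interval I \<and> 0 < measure circle_lebesgue I \<and>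
            ereal (measure circle_lebesgue I) < 1 / q \<longrightarrow>
          upper_limit_measure (\<lambda>k. circle_mult (n k) \<alpha>) I
            > Q / (- ln (measure circle_lebesgue I))})"
proof -
  obtain r where r: "1 < ereal r" "ereal r < q" using ereal_dense2[OF assms(3)] by blast
  then have "\<forall>\<^sub>F k in sequentially. ereal r < ereal (real (n (Suc k)) / real (n k))"
    unfolding assms(2) by (intro less_LiminfD)
  then obtain K where K: "\<And>k. k \<ge> K \<Longrightarrow> r < real (n (Suc k)) / real (n k)"
    unfolding eventually_sequentially by auto
  interpret lacunary n r K
  proof
    show "1 < r" using r(1) by simp
    show "0 < n k" for k by (rule assms(1))
    show "r * real (n k) \<le> real (n (Suc k))" if "K \<le> k" for k
      using K[OF that] assms(1)[of k] by (simp add: field_simps)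
  qed
  \<comment> \<open>From \<open>r < q\<close> follows \<open>1 / q \<le> 1 / r\<close>, also for
    infinite \<open>q\<close>, where \<open>1 / q\<close> is 0.\<close>
  have less: "x < 1 / r" if "ereal x < 1 / q" for x
  proof -
    have "1 / q \<le> ereal (1 / r)" using r by (cases q) (auto simp: frac_le one_ereal_def)
    with that have "ereal x < ereal (1 / r)" by (rule order_less_le_trans)
    then show ?thesis by simp
  qed
  \<comment> \<open>The simultaneous statement is proved first; the one for a single interval
    follows by enlarging the set.\<close>
  have sub: "generic \<subseteq> {\<alpha>. \<forall>I. circle_interval I \<and> 0 < measure circle_lebesgue I \<and>
            ereal (measure circle_lebesgue I) < 1 / q \<longrightarrow>
          upper_limit_measure (\<lambda>k. circle_mult (n k) \<alpha>) I
            > gap_const / (- ln (measure circle_lebesgue I))}"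
    using generic_upper_limit_measure less by blast
  show ?thesis
  proof (intro conjI exI[of _ gap_const] allI impI)
    show "meager {\<alpha>. uniformly_distributed_wrt circle_lebesgue (\<lambda>k. circle_mult (n k) \<alpha>)}"
      using residual_generic[unfolded residual_def]
      by (rule meager_subset) (use generic_not_uniformly_distributed in blast)
    show "0 < gap_const" by (rule gap_const_pos)
    show "residual {\<alpha>. \<forall>I. circle_interval I \<and> 0 < measure circle_lebesgue I \<and>
            ereal (measure circle_lebesgue I) < 1 / q \<longrightarrow>
          upper_limit_measure (\<lambda>k. circle_mult (n k) \<alpha>) I
            > gap_const / (- ln (measure circle_lebesgue I))}"
      by (rule residual_mono[OF residual_generic sub])
    fix I assume "circle_interval I \<and> 0 < measure circle_lebesgue I \<and>
            ereal (measure circle_lebesgue I) < 1 / q"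
    then show "residual {\<alpha>. upper_limit_measure (\<lambda>k. circle_mult (n k) \<alpha>) I
                        > gap_const / (- ln (measure circle_lebesgue I))}"
      using sub by (intro residual_mono[OF residual_generic]) blast
  qed
qed

end
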